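(* Let $a,b>0$ with $a\neq b$. Then for each choice of sign $\pm$ (the same choice throughout) and for all $(x,\xi)\in\mathbb{R}^2$, $$A(\eta_a*\eta_{\pm b},\,\eta_a*\eta_{\pm b})(x,\xi)=\frac{1}{2(b^2-a^2)+4\pi i(\pm b-a)\xi}\left(\frac{e^{-(a+\pi i\xi)|x|}}{a+\pi i\xi}-\frac{e^{-(b\pm\pi i\xi)|x|}}{b\pm\pi i\xi}\right).$$ Furthermore, $A(\eta_a*\eta_{\pm b},\,\eta_a*\eta_{\pm b})$ has no zeros in $\mathbb{R}^2$.
   Context: For $a>0$, $\eta_a(t)=e^{-at}\mathbf{1}_{(0,+\infty)}(t)$ for $t\in\mathbb{R}$, and $\eta_{-a}(t)=\eta_a(-t)$. The symbol $*$ denotes convolution on $\mathbb{R}$. The ambiguity function of $f,g\in L^2(\mathbb{R})$ is $$A(f,g)(x,\xi)=\int_{\mathbb{R}} f\left(t+\tfrac{x}{2}\right)\overline{g\left(t-\tfrac{x}{2}\right)}\,e^{-2\pi i\xi t}\,dt,\qquad (x,\xi)\in\mathbb{R}^2.$$ *)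

theory Defs
  imports "HOL-Analysis.Analysis"
begin

definition eta_pos :: "real \<Rightarrow> real \<Rightarrow> complex" where
  "eta_pos a t = of_real (exp (- a * t) * indicator {0<..} t)"

text \<open>For negative index, \<open>\<eta>\<^bsub>-a\<^esub>(t) = \<eta>\<^bsub>a\<^esub>(-t)\<close>.
  The index \<open>0\<close> has no mathematical meaning here; its value is arbitrary.\<close>
definition eta :: "real \<Rightarrow> real \<Rightarrow> complex" where
  "eta c t = (if c > 0 then eta_pos c t else eta_pos (- c) (- t))"

definition conv :: "(real \<Rightarrow> complex) \<Rightarrow> (real \<Rightarrow> complex) \<Rightarrow> real \<Rightarrow> complex" where
  "conv f g t = (LINT s|lborel. f s * g (t - s))"

definition ambiguity ::
    "(real \<Rightarrow> complex) \<Rightarrow> (real \<Rightarrow> complex) \<Rightarrow> real \<Rightarrow> real \<Rightarrow> complex" where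
  "ambiguity f g x \<xi> =
     (LINT t|lborel. f (t + x / 2) * cnj (g (t - x / 2)) *
        exp (- 2 * of_real pi * \<i> * of_real \<xi> * of_real t))"

end

theory Submission
  imports Defs
begin

text \<open>
  Fix \<open>\<xi>\<close> and put \<open>A = a + \<pi>i\<xi>\<close> and \<open>B = b + \<sigma>\<pi>i\<xi>\<close>, where \<open>\<sigma>\<close> is the sign. Since \<open>\<sigma>\<^sup>2 = 1\<close>, the
  denominator in the claimed formula is \<open>2 (B\<^sup>2 - A\<^sup>2)\<close>, so both signs give the same expression
  \<open>(e\<^bsup>-A|x|\<^esup> / A - e\<^bsup>-B|x|\<^esup> / B) / (2 (B\<^sup>2 - A\<^sup>2))\<close>.

  Both convolutions are elementary. For \<open>\<sigma> = 1\<close> the result is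
  \<open>(e\<^bsup>-at\<^esup> - e\<^bsup>-bt\<^esup>) / (b - a)\<close> on the positive half-line and \<open>0\<close> elsewhere
  (\<open>conv_eta_same_side\<close>). For \<open>\<sigma> = -1\<close> it is the two-sided exponential with value
  \<open>e\<^bsup>-at\<^esup> / (a + b)\<close> for \<open>t > 0\<close> and \<open>e\<^bsup>bt\<^esup> / (a + b)\<close> for \<open>t \<le> 0\<close>
  (\<open>conv_eta_opposite_sides\<close>). These functions are real-valued, so the ambiguity function is
  even in \<open>x\<close> and \<open>x \<ge> 0\<close> may be assumed. The integrand is then piecewise a sum of exponentials
  of the real variable, all of whose exponents are combinations of \<open>A\<close> and \<open>B\<close>, including the
  factor \<open>e\<^bsup>-2\<pi>i\<xi>t\<^esup>\<close>. Integrating each piece and collecting the coefficients of \<open>e\<^bsup>-Ax\<^esup>\<close>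
  and \<open>e\<^bsup>-Bx\<^esup>\<close> gives the formula, by one partial fraction identity for each sign
  (\<open>ambiguity_same_side\<close>, \<open>ambiguity_opposite_sides\<close>).

  The absence of zeros is a comparison of moduli. The imaginary parts of \<open>A\<close> and \<open>B\<close> agree up to
  sign, and \<open>|e\<^bsup>-zr\<^esup> / z|\<close> with \<open>r \<ge> 0\<close> strictly decreases when the real part of \<open>z\<close> grows
  through positive values while \<open>|Im z|\<close> stays the same (\<open>exp_over_neq\<close>). As the real parts
  \<open>a\<close> and \<open>b\<close> differ, the two terms in the numerator have different moduli.
\<close>

section \<open>Integrals of complex exponentials\<close>

text \<open>
  Absolute integrability comes from \<open>|e\<^bsup>ct\<^esup>| = e\<^bsup>(Re c) t\<^esup>\<close>. It allows the value to be computed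
  as the limit of the integrals over \<open>[p, y]\<close>, which the fundamental theorem of calculus gives.
\<close>
lemma has_bochner_integral_exp_tail:
  fixes c :: complex and p :: real
  assumes "Re c < 0"
  shows "has_bochner_integral lborel
           (\<lambda>t. indicator {p<..} t *\<^sub>R exp (c * of_real t)) (- exp (c * of_real p) / c)"
proof -
  have c0: "c \<noteq> 0" using assms by auto
  \<comment> \<open>The closed half-line intersects \<open>{..y}\<close> in a closed interval; the endpoint \<open>p\<close> is a null set.\<close>
  define g where "g = (\<lambda>t. indicator {p..} t *\<^sub>R exp (c * of_real t))"
  have g_measurable: "g \<in> borel_measurable lborel"
    unfolding g_def by measurable
  have "(\<lambda>t. exp (- (- Re c) * t)) absolutely_integrable_on {p..}"
    using assms by (intro nonnegative_absolutely_integrable_1 integrable_on_exp_minus_to_infinity) auto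
  then have "integrable lborel (\<lambda>t. indicator {p..} t *\<^sub>R exp (Re c * t))"
    unfolding set_integrable_def by (subst (asm) integrable_completion) auto
  then have int: "integrable lborel g"
    by (rule Bochner_Integration.integrable_bound) (use g_measurable in \<open>auto simp: g_def\<close>)
  have "((\<lambda>y. \<integral>t. indicator {..y} t *\<^sub>R g t \<partial>lborel) \<longlongrightarrow> integral\<^sup>L lborel g) at_top"
    by (rule tendsto_integral_at_top[OF _ int]) simp
  moreover have "\<forall>\<^sub>F y in at_top. (\<integral>t. indicator {..y} t *\<^sub>R g t \<partial>lborel)
                    = exp (c * of_real y) / c - exp (c * of_real p) / c"
    using eventually_ge_at_top[of p]
  proof eventually_elim
    case (elim y)
    have "(\<integral>t. indicator {..y} t *\<^sub>R g t \<partial>lborel)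
            = (\<integral>t. indicator {p..y} t *\<^sub>R exp (c * of_real t) \<partial>lborel)"
      by (intro Bochner_Integration.integral_cong) (auto simp: g_def indicator_def)
    also have "\<dots> = exp (c * of_real y) / c - exp (c * of_real p) / c"
      using elim c0
      by (intro integral_FTC_atLeastAtMost)
         (auto intro!: derivative_eq_intros continuous_intros has_vector_derivative_real_field)
    finally show ?case .
  qed
  ultimately have "((\<lambda>y. exp (c * of_real y) / c - exp (c * of_real p) / c)
                      \<longlongrightarrow> integral\<^sup>L lborel g) at_top"
    by (rule Lim_transform_eventually)
  moreover have "((\<lambda>y. exp (c * of_real y) / c - exp (c * of_real p) / c)
                      \<longlongrightarrow> 0 / c - exp (c * of_real p) / c) at_top"
  proof (intro tendsto_intros)
    have "filterlim (\<lambda>y. Re c * y) at_bot at_top"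
      using assms by (intro filterlim_tendsto_neg_mult_at_bot[OF tendsto_const]) (auto intro: filterlim_ident)
    then have "((\<lambda>y. exp (Re c * y)) \<longlongrightarrow> 0) at_top"
      by (rule filterlim_compose[OF exp_at_bot])
    then show "((\<lambda>y. exp (c * of_real y)) \<longlongrightarrow> 0) at_top"
      by (subst tendsto_norm_zero_iff[symmetric]) simp
  qed (use c0 in auto)
  ultimately have "integral\<^sup>L lborel g = 0 / c - exp (c * of_real p) / c"
    by (rule tendsto_unique[rotated]) simp
  with int have "has_bochner_integral lborel g (- exp (c * of_real p) / c)"
    by (simp add: has_bochner_integral_iff)
  then show ?thesis
    by (rule has_bochner_integral_discrete_difference[where X="{p}", THEN iffD1, rotated 4])
       (auto simp: g_def indicator_def)
qed

lemma has_bochner_integral_exp_head: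
  fixes c :: complex and p :: real
  assumes "Re c > 0"
  shows "has_bochner_integral lborel
           (\<lambda>t. indicator {..<p} t *\<^sub>R exp (c * of_real t)) (exp (c * of_real p) / c)"
proof (subst lborel_has_bochner_integral_real_affine_iff[where c="-1" and t=0])
  have "(\<lambda>t. indicator {..<p} (0 + - 1 * t) *\<^sub>R exp (c * of_real (0 + - 1 * t)))
        = (\<lambda>t. indicator {- p<..} t *\<^sub>R exp (- c * of_real t))"
    by (auto simp: indicator_def)
  then show "has_bochner_integral lborel
      (\<lambda>t. indicator {..<p} (0 + - 1 * t) *\<^sub>R exp (c * of_real (0 + - 1 * t)))
      ((exp (c * of_real p) / c) /\<^sub>R \<bar>- 1\<bar>)"
    using has_bochner_integral_exp_tail[of "- c" "- p"] assms by simp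
qed simp

lemma has_bochner_integral_exp_segment:
  fixes c :: complex and p q :: real
  assumes "c \<noteq> 0" and "p \<le> q"
  shows "has_bochner_integral lborel
           (\<lambda>t. indicator {p<..<q} t *\<^sub>R exp (c * of_real t))
           ((exp (c * of_real q) - exp (c * of_real p)) / c)"
proof -
  have "has_bochner_integral lborel (\<lambda>t. indicator {p..q} t *\<^sub>R exp (c * of_real t))
          (exp (c * of_real q) / c - exp (c * of_real p) / c)"
    using assms
    by (intro has_bochner_integral_FTC_Icc)
       (auto intro!: derivative_eq_intros continuous_intros has_vector_derivative_real_field)
  then have "has_bochner_integral lborel (\<lambda>t. indicator {p<..<q} t *\<^sub>R exp (c * of_real t))
          (exp (c * of_real q) / c - exp (c * of_real p) / c)"
    by (rule has_bochner_integral_discrete_difference[where X="{p, q}", THEN iffD1, rotated 4])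
       (auto simp: indicator_def)
  then show ?thesis by (simp add: diff_divide_distrib)
qed

section \<open>The two convolutions\<close>

text \<open>
  For \<open>t > 0\<close> both factors are nonzero exactly when \<open>0 < s < t\<close>, where their product is
  \<open>e\<^bsup>-bt\<^esup> e\<^bsup>(b-a)s\<^esup>\<close>; for \<open>t \<le> 0\<close> the supports are disjoint.
\<close>
lemma conv_eta_same_side:
  fixes a b :: real
  assumes "a > 0" and "b > 0" and "a \<noteq> b"
  shows "conv (eta a) (eta b) t =
           of_real (indicator {0<..} t * (exp (- a * t) - exp (- b * t)) / (b - a))"
proof (cases "t > 0")
  case True
  have "conv (eta a) (eta b) t =
      (\<integral>s. exp (of_real (- b * t)) *
         (indicator {0<..<t} s *\<^sub>R exp (of_real (b - a) * of_real s)) \<partial>lborel)"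
    unfolding conv_def using assms
    by (intro Bochner_Integration.integral_cong)
       (auto simp: eta_def eta_pos_def indicator_def exp_of_real[symmetric] mult_exp_exp algebra_simps)
  also have "\<dots> = exp (of_real (- b * t)) *
      ((exp (of_real (b - a) * of_real t) - exp (of_real (b - a) * of_real 0)) / of_real (b - a))"
    using assms True
    by (intro has_bochner_integral_integral_eq has_bochner_integral_mult_right
              has_bochner_integral_exp_segment) auto
  also have "\<dots> = of_real ((exp (- a * t) - exp (- b * t)) / (b - a))"
    by (simp add: exp_of_real[symmetric] mult_exp_exp algebra_simps)
  finally show ?thesis using True by simp
next
  case False
  have "conv (eta a) (eta b) t = (\<integral>s. 0 \<partial>(lborel :: real measure))"
    unfolding conv_def using assms False
    by (intro Bochner_Integration.integral_cong) (auto simp: eta_def eta_pos_def indicator_def)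
  then show ?thesis using False by simp
qed

text \<open>
  Both factors are nonzero exactly when \<open>s > max 0 t\<close>, where their product is
  \<open>e\<^bsup>bt\<^esup> e\<^bsup>-(a+b)s\<^esup>\<close>.
\<close>
lemma conv_eta_opposite_sides:
  fixes a b :: real
  assumes "a > 0" and "b > 0"
  shows "conv (eta a) (eta (- b)) t =
           of_real ((if t > 0 then exp (- a * t) else exp (b * t)) / (a + b))"
proof -
  have "conv (eta a) (eta (- b)) t =
      (\<integral>s. exp (of_real (b * t)) *
         (indicator {max 0 t<..} s *\<^sub>R exp (of_real (- (a + b)) * of_real s)) \<partial>lborel)"
    unfolding conv_def using assms
    by (intro Bochner_Integration.integral_cong)
       (auto simp: eta_def eta_pos_def indicator_def exp_of_real[symmetric] mult_exp_exp algebra_simps)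
  also have "\<dots> = exp (of_real (b * t)) *
      (- exp (of_real (- (a + b)) * of_real (max 0 t)) / of_real (- (a + b)))"
    using assms
    by (intro has_bochner_integral_integral_eq has_bochner_integral_mult_right
              has_bochner_integral_exp_tail) auto
  also have "\<dots> = of_real (exp (b * t) * exp (- (a + b) * max 0 t) / (a + b))"
    by (simp only: of_real_minus minus_divide_divide exp_of_real[symmetric] of_real_mult of_real_divide times_divide_eq_right)
  also have "exp (b * t) * exp (- (a + b) * max 0 t) = (if t > 0 then exp (- a * t) else exp (b * t))"
    by (auto simp: mult_exp_exp max_def algebra_simps)
  finally show ?thesis .
qed

section \<open>The ambiguity functions\<close>

text \<open>
  For real-valued \<open>f\<close> the conjugate disappears, and replacing \<open>x\<close> by \<open>-x\<close> only swaps the two factors.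
\<close>
lemma ambiguity_real_valued_uminus:
  assumes "\<And>t. f t \<in> \<real>"
  shows "ambiguity f f (- x) \<xi> = ambiguity f f x \<xi>"
  using assms unfolding ambiguity_def
  by (simp add: Reals_cnj_iff mult.commute)


text \<open>
  The left-hand sides are what integrating piece by piece leaves for equal and for opposite signs
  respectively, with \<open>P = e\<^bsup>-Ax\<^esup>\<close> and \<open>Q = e\<^bsup>-Bx\<^esup>\<close>.
\<close>
lemma partial_fractions:
  fixes A B P Q :: complex
  assumes "A \<noteq> 0" "B \<noteq> 0" "A + B \<noteq> 0" "B - A \<noteq> 0"
  shows "1 / (B - A) ^ 2 * (P / (2 * A) + Q / (2 * B) - (P + Q) / (A + B)) =
           (P / A - Q / B) / (2 * (B ^ 2 - A ^ 2))"
    and "1 / (A + B) ^ 2 * (P / (2 * A) + Q / (2 * B) + (P - Q) / (B - A)) =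
           (P / A - Q / B) / (2 * (B ^ 2 - A ^ 2))"
proof -
  have sq: "B ^ 2 - A ^ 2 = (B - A) * (A + B)" by (simp add: algebra_simps power2_eq_square)
  show "1 / (B - A) ^ 2 * (P / (2 * A) + Q / (2 * B) - (P + Q) / (A + B)) =
           (P / A - Q / B) / (2 * (B ^ 2 - A ^ 2))"
    unfolding sq using assms by (simp add: divide_simps) algebra
  show "1 / (A + B) ^ 2 * (P / (2 * A) + Q / (2 * B) + (P - Q) / (B - A)) =
           (P / A - Q / B) / (2 * (B ^ 2 - A ^ 2))"
    unfolding sq using assms by (simp add: divide_simps) algebra
qed

text \<open>
  The integrand lives on \<open>t > x/2\<close>. Expanding the product of the two differences there gives four
  exponentials. Two of them have rates \<open>2A\<close> and \<open>2B\<close>; the mixed ones both have rate \<open>A + B\<close>,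
  with constant factors \<open>e\<^bsup>\<plusminus>(B-A)x/2\<^esup>\<close>.
\<close>
lemma ambiguity_same_side:
  fixes a b x \<xi> :: real
  defines "A \<equiv> Complex a (pi * \<xi>)" and "B \<equiv> Complex b (pi * \<xi>)"
  assumes "a > 0" and "b > 0" and "a \<noteq> b" and "x \<ge> 0"
  shows "ambiguity (conv (eta a) (eta b)) (conv (eta a) (eta b)) x \<xi> =
           (exp (- A * of_real x) / A - exp (- B * of_real x) / B) / (2 * (B ^ 2 - A ^ 2))"
proof -
  define u where "u = (of_real (x / 2) :: complex)"
  have AB: "A = of_real a + of_real pi * \<i> * of_real \<xi>"
           "B = of_real b + of_real pi * \<i> * of_real \<xi>"
    by (simp_all add: A_def B_def complex_eq_iff)
  have ba: "of_real (b - a) = B - A"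
    by (simp add: A_def B_def complex_eq_iff)
  have nz: "A \<noteq> 0" "B \<noteq> 0" "A + B \<noteq> 0" "B - A \<noteq> 0"
    using assms by (auto simp: A_def B_def complex_eq_iff)
  have "ambiguity (conv (eta a) (eta b)) (conv (eta a) (eta b)) x \<xi> =
      (\<integral>t. 1 / (B - A) ^ 2 *
         (indicator {x / 2<..} t *\<^sub>R exp (- (2 * A) * of_real t)
          + indicator {x / 2<..} t *\<^sub>R exp (- (2 * B) * of_real t)
          - (exp ((B - A) * u) + exp (- ((B - A) * u))) *
            (indicator {x / 2<..} t *\<^sub>R exp (- (A + B) * of_real t))) \<partial>lborel)"
    unfolding ambiguity_def
  proof (intro Bochner_Integration.integral_cong refl)
    fix t :: real
    show "conv (eta a) (eta b) (t + x / 2) * cnj (conv (eta a) (eta b) (t - x / 2)) *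
        exp (- 2 * of_real pi * \<i> * of_real \<xi> * of_real t) =
      1 / (B - A) ^ 2 *
         (indicator {x / 2<..} t *\<^sub>R exp (- (2 * A) * of_real t)
          + indicator {x / 2<..} t *\<^sub>R exp (- (2 * B) * of_real t)
          - (exp ((B - A) * u) + exp (- ((B - A) * u))) *
            (indicator {x / 2<..} t *\<^sub>R exp (- (A + B) * of_real t)))"
    proof (cases "t > x / 2")
      case True
      have "conv (eta a) (eta b) (t + x / 2) * cnj (conv (eta a) (eta b) (t - x / 2)) *
        exp (- 2 * of_real pi * \<i> * of_real \<xi> * of_real t)
        = 1 / of_real (b - a) ^ 2 *
          ((exp (- of_real a * (of_real t + u)) - exp (- of_real b * (of_real t + u))) *
           (exp (- of_real a * (of_real t - u)) - exp (- of_real b * (of_real t - u))) *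
            exp (- 2 * of_real pi * \<i> * of_real \<xi> * of_real t))"
        using True \<open>x \<ge> 0\<close> unfolding conv_eta_same_side[OF assms(3-5)] u_def
        by (simp add: exp_of_real[symmetric] power2_eq_square exp_cnj)
      also have "\<dots> = 1 / (B - A) ^ 2 *
         (exp (- (2 * A) * of_real t) + exp (- (2 * B) * of_real t)
          - (exp ((B - A) * u) + exp (- ((B - A) * u))) * exp (- (A + B) * of_real t))"
        unfolding ba unfolding AB by (simp add: ring_distribs mult_exp_exp) (simp add: algebra_simps)
      finally show ?thesis using True by simp
    next
      case False
      then show ?thesis unfolding conv_eta_same_side[OF assms(3-5)] by simp
    qed
  qed
  also have "\<dots> = 1 / (B - A) ^ 2 *
         (- exp (- (2 * A) * u) / (- (2 * A)) + - exp (- (2 * B) * u) / (- (2 * B))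
          - (exp ((B - A) * u) + exp (- ((B - A) * u))) * (- exp (- (A + B) * u) / (- (A + B))))"
    unfolding u_def using assms
    by (intro has_bochner_integral_integral_eq has_bochner_integral_mult_right
          has_bochner_integral_add has_bochner_integral_diff has_bochner_integral_exp_tail)
       auto
  also have "(exp ((B - A) * u) + exp (- ((B - A) * u))) * (- exp (- (A + B) * u) / (- (A + B)))
      = (exp (- (2 * A) * u) + exp (- (2 * B) * u)) / (A + B)"
    unfolding minus_divide_divide by (simp add: distrib_right mult_exp_exp) (simp add: algebra_simps)
  also have "- (2 * A) * u = - A * of_real x" by (simp add: u_def)
  also have "- (2 * B) * u = - B * of_real x" by (simp add: u_def)
  finally show ?thesis unfolding minus_divide_divide using nz partial_fractions by metis
qed

text \<open>
  The two arguments \<open>t \<plusminus> x/2\<close> are both positive for \<open>t > x/2\<close>, both negative for \<open>t < -x/2\<close>, and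
  of opposite signs in between. The product, including \<open>e\<^bsup>-2\<pi>i\<xi>t\<^esup>\<close>, is accordingly a multiple of
  \<open>e\<^bsup>-2At\<^esup>\<close>, of \<open>e\<^bsup>2Bt\<^esup>\<close> and of \<open>e\<^bsup>(B-A)t\<^esup>\<close>. The middle rate has real part
  \<open>b - a\<close>, of unknown sign but nonzero, so that its integral over the bounded interval is a quotient.
\<close>
lemma ambiguity_opposite_sides:
  fixes a b x \<xi> :: real
  defines "A \<equiv> Complex a (pi * \<xi>)" and "B \<equiv> Complex b (- pi * \<xi>)"
  assumes "a > 0" and "b > 0" and "a \<noteq> b" and "x \<ge> 0"
  shows "ambiguity (conv (eta a) (eta (- b))) (conv (eta a) (eta (- b))) x \<xi> =
           (exp (- A * of_real x) / A - exp (- B * of_real x) / B) / (2 * (B ^ 2 - A ^ 2))"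
proof -
  define u where "u = (of_real (x / 2) :: complex)"
  have minus_u: "of_real (- x / 2) = - u"
    by (simp add: u_def)
  define F where "F = conv (eta a) (eta (- b))"
  have F: "F t = exp (of_real (if t > 0 then - a * t else b * t)) / of_real (a + b)" for t
    unfolding F_def conv_eta_opposite_sides[OF assms(3,4)] by (simp add: exp_of_real[symmetric])
  have ab: "of_real (a + b) = A + B"
    by (simp add: A_def B_def complex_eq_iff)
  have nz: "A \<noteq> 0" "B \<noteq> 0" "A + B \<noteq> 0" "B - A \<noteq> 0"
    using assms by (auto simp: A_def B_def complex_eq_iff)
  have AB: "A = of_real a + of_real pi * \<i> * of_real \<xi>"
           "B = of_real b - of_real pi * \<i> * of_real \<xi>"
    by (simp_all add: A_def B_def complex_eq_iff)
  have "has_bochner_integral lborel (\<lambda>t. 1 / (A + B) ^ 2 *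
         (indicator {x / 2<..} t *\<^sub>R exp (- (2 * A) * of_real t)
          + indicator {..<- x / 2} t *\<^sub>R exp (2 * B * of_real t)
          + exp (- (A + B) * u) *
            (indicator {- x / 2<..<x / 2} t *\<^sub>R exp ((B - A) * of_real t))))
         (1 / (A + B) ^ 2 *
         (- exp (- (2 * A) * u) / (- (2 * A)) + exp (2 * B * of_real (- x / 2)) / (2 * B)
          + exp (- (A + B) * u) * ((exp ((B - A) * u) - exp ((B - A) * of_real (- x / 2))) / (B - A))))"
    unfolding u_def using assms(3-6) nz
    by (intro has_bochner_integral_mult_right has_bochner_integral_add
          has_bochner_integral_exp_tail has_bochner_integral_exp_head has_bochner_integral_exp_segment)
       (auto simp: A_def B_def)
  then have "has_bochner_integral lborel
      (\<lambda>t. F (t + x / 2) * cnj (F (t - x / 2)) * exp (- 2 * of_real pi * \<i> * of_real \<xi> * of_real t))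
         (1 / (A + B) ^ 2 *
         (- exp (- (2 * A) * u) / (- (2 * A)) + exp (2 * B * of_real (- x / 2)) / (2 * B)
          + exp (- (A + B) * u) * ((exp ((B - A) * u) - exp ((B - A) * of_real (- x / 2))) / (B - A))))"
  \<comment> \<open>The three open pieces leave out the two break points, which are null sets.\<close>
  proof (rule has_bochner_integral_discrete_difference[where X="{- x / 2, x / 2}", THEN iffD1, rotated 4])
    fix t :: real
    assume t: "t \<notin> {- x / 2, x / 2}"
    have cnj_F: "cnj (F s) = F s" for s
      by (simp add: F exp_cnj)
    consider "t > x / 2" | "t < - x / 2" | "- x / 2 < t" "t < x / 2"
      using t by force
    then show "1 / (A + B) ^ 2 *
         (indicator {x / 2<..} t *\<^sub>R exp (- (2 * A) * of_real t)
          + indicator {..<- x / 2} t *\<^sub>R exp (2 * B * of_real t)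
          + exp (- (A + B) * u) *
            (indicator {- x / 2<..<x / 2} t *\<^sub>R exp ((B - A) * of_real t))) =
      F (t + x / 2) * cnj (F (t - x / 2)) * exp (- 2 * of_real pi * \<i> * of_real \<xi> * of_real t)"
    proof cases
      case 1
      then show ?thesis using \<open>x \<ge> 0\<close> unfolding cnj_F unfolding F ab
        by (simp add: power2_eq_square mult_exp_exp) (simp add: AB algebra_simps)
    next
      case 2
      then show ?thesis using \<open>x \<ge> 0\<close> unfolding cnj_F unfolding F ab
        by (simp add: power2_eq_square mult_exp_exp) (simp add: AB algebra_simps)
    next
      case 3
      then show ?thesis using \<open>x \<ge> 0\<close> unfolding cnj_F unfolding F ab
        by (simp add: power2_eq_square mult_exp_exp)
           (simp add: AB u_def algebra_simps add_divide_distrib diff_divide_distrib)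
    qed
  qed auto
  then have "ambiguity F F x \<xi> = 1 / (A + B) ^ 2 *
         (- exp (- (2 * A) * u) / (- (2 * A)) + exp (2 * B * of_real (- x / 2)) / (2 * B)
          + exp (- (A + B) * u) * ((exp ((B - A) * u) - exp ((B - A) * of_real (- x / 2))) / (B - A)))"
    unfolding ambiguity_def by (rule has_bochner_integral_integral_eq)
  also have "exp (- (A + B) * u) * ((exp ((B - A) * u) - exp ((B - A) * of_real (- x / 2))) / (B - A))
      = (exp (- (2 * A) * u) - exp (- (2 * B) * u)) / (B - A)"
    unfolding minus_u by (simp add: right_diff_distrib mult_exp_exp) (simp add: algebra_simps)
  also have "- (2 * A) * u = - A * of_real x" by (simp add: u_def)
  also have "- (2 * B) * u = - B * of_real x" by (simp add: u_def)
  also have "2 * B * of_real (- x / 2) = - B * of_real x" by simp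
  finally show ?thesis
    unfolding minus_divide_divide F_def using nz partial_fractions by metis
qed

section \<open>The formula and the absence of zeros\<close>

text \<open>
  Passing from \<open>A\<close> to \<open>B\<close>, the modulus \<open>e\<^bsup>-(Re z) r\<^esup>\<close> of the numerator does not increase, and
  the modulus of the denominator \<open>z\<close> strictly increases.
\<close>
lemma exp_over_neq:
  fixes A B :: complex and r :: real
  assumes "0 < Re A" and "Re A < Re B" and "\<bar>Im A\<bar> = \<bar>Im B\<bar>" and "r \<ge> 0"
  shows "exp (- A * of_real r) / A \<noteq> exp (- B * of_real r) / B"
proof -
  have "norm A < norm B"
    using assms power_strict_mono[of "Re A" "Re B" 2]
    by (auto simp: cmod_def abs_eq_iff' power2_eq_square[symmetric])
  moreover have "0 < norm A" using assms by auto
  moreover have "exp (- Re B * r) \<le> exp (- Re A * r)"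
    using assms by (simp add: mult_right_mono)
  ultimately have "exp (- Re B * r) / norm B < exp (- Re A * r) / norm A"
    by (intro frac_less2) auto
  then have "norm (exp (- B * of_real r) / B) < norm (exp (- A * of_real r) / A)"
    by (simp add: norm_divide)
  then show ?thesis by auto
qed

theorem lemma3p1:
  fixes a b \<sigma> :: real
  assumes "a > 0" and "b > 0" and "a \<noteq> b" and "\<sigma> \<in> {1, - 1}"
  shows "(\<forall>x \<xi> :: real.
            ambiguity (conv (eta a) (eta (\<sigma> * b))) (conv (eta a) (eta (\<sigma> * b))) x \<xi> =
              1 / (2 * (of_real b ^ 2 - of_real a ^ 2)
                    + 4 * of_real pi * \<i> * (of_real \<sigma> * of_real b - of_real a) * of_real \<xi>) *
              (exp (- (of_real a + of_real pi * \<i> * of_real \<xi>) * of_real \<bar>x\<bar>)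
                  / (of_real a + of_real pi * \<i> * of_real \<xi>)
               - exp (- (of_real b + of_real \<sigma> * of_real pi * \<i> * of_real \<xi>) * of_real \<bar>x\<bar>)
                  / (of_real b + of_real \<sigma> * of_real pi * \<i> * of_real \<xi>)))
       \<and> (\<forall>x \<xi> :: real.
            ambiguity (conv (eta a) (eta (\<sigma> * b))) (conv (eta a) (eta (\<sigma> * b))) x \<xi> \<noteq> 0)"
proof -
  define F where "F = conv (eta a) (eta (\<sigma> * b))"
  define A where "A = (\<lambda>\<xi>. Complex a (pi * \<xi>))"
  define B where "B = (\<lambda>\<xi>. Complex b (\<sigma> * pi * \<xi>))"
  have A: "of_real a + of_real pi * \<i> * of_real \<xi> = A \<xi>"
    and B: "of_real b + of_real \<sigma> * of_real pi * \<i> * of_real \<xi> = B \<xi>" for \<xi>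
    by (simp_all add: A_def B_def complex_eq_iff)
  have denominator: "2 * (of_real b ^ 2 - of_real a ^ 2)
      + 4 * of_real pi * \<i> * (of_real \<sigma> * of_real b - of_real a) * of_real \<xi>
      = 2 * (B \<xi> ^ 2 - A \<xi> ^ 2)" for \<xi>
    using assms(4) by (auto simp: A_def B_def complex_eq_iff power2_eq_square algebra_simps)
  have "F t \<in> \<real>" for t
    using assms by (auto simp: F_def conv_eta_same_side conv_eta_opposite_sides)
  then have "ambiguity F F x \<xi> = ambiguity F F \<bar>x\<bar> \<xi>" for x \<xi>
    using ambiguity_real_valued_uminus[of F x] by (simp add: abs_if)
  moreover have "ambiguity F F \<bar>x\<bar> \<xi> =
      (exp (- A \<xi> * of_real \<bar>x\<bar>) / A \<xi> - exp (- B \<xi> * of_real \<bar>x\<bar>) / B \<xi>) / (2 * (B \<xi> ^ 2 - A \<xi> ^ 2))"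
    for x \<xi>
    using assms ambiguity_same_side[of a b "\<bar>x\<bar>" \<xi>] ambiguity_opposite_sides[of a b "\<bar>x\<bar>" \<xi>]
    by (auto simp: F_def A_def B_def)
  ultimately have formula: "ambiguity F F x \<xi> =
      (exp (- A \<xi> * of_real \<bar>x\<bar>) / A \<xi> - exp (- B \<xi> * of_real \<bar>x\<bar>) / B \<xi>) / (2 * (B \<xi> ^ 2 - A \<xi> ^ 2))"
    for x \<xi>
    by simp
  have "ambiguity F F x \<xi> \<noteq> 0" for x \<xi>
  proof -
    have "A \<xi> \<noteq> B \<xi>" "A \<xi> \<noteq> - B \<xi>"
      using assms by (auto simp: A_def B_def complex_eq_iff)
    then have "B \<xi> ^ 2 - A \<xi> ^ 2 \<noteq> 0"
      by (auto simp: power2_eq_iff)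
    moreover have "\<bar>Im (A \<xi>)\<bar> = \<bar>Im (B \<xi>)\<bar>"
      using assms(4) by (auto simp: A_def B_def)
    then have "exp (- A \<xi> * of_real \<bar>x\<bar>) / A \<xi> \<noteq> exp (- B \<xi> * of_real \<bar>x\<bar>) / B \<xi>"
      using assms(1-3) exp_over_neq[of "A \<xi>" "B \<xi>" "\<bar>x\<bar>"] exp_over_neq[of "B \<xi>" "A \<xi>" "\<bar>x\<bar>"]
      by (fastforce simp: A_def B_def)
    ultimately show ?thesis unfolding formula by simp
  qed
  then show ?thesis
    unfolding A B denominator F_def[symmetric] by (simp add: formula)
qed

end
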